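(* Let $r_S$ and $r_T$ be solutions on sets $S$ and $T$, and let $(r_S,r_T,\alpha,\beta)$ be a matched product system of solutions. Then the solutions $r_S$ and $r_T$ are of finite order if and only if the solution $r_S\bowtie r_T$ on $S\times T$ is of finite order.
   Context: A (set-theoretical) solution on a set $X$ is a map $r:X\times X\to X\times X$ (not necessarily bijective) with $(r\times \mathrm{id}_X)(\mathrm{id}_X\times r)(r\times \mathrm{id}_X)=(\mathrm{id}_X\times r)(r\times \mathrm{id}_X)(\mathrm{id}_X\times r)$. One writes $r(x,y)=(\lambda_x(y),\rho_y(x))$; the same letters $\lambda,\rho$ are used for the component maps of every solution. Powers $r^n$ are iterated compositions, $r^0=\mathrm{id}$. A solution $r$ is of finite order if there exist integers $i\ge 0$ and $p\ge 1$ with $r^{p+i}=r^i$. Matched product system: let $r_S$, $r_T$ be solutions on $S$, $T$, and let $\alpha:T\to\mathrm{Sym}(S)$, $\beta:S\to\mathrm{Sym}(T)$ be maps; write $\alpha_u=\alpha(u)$, $\beta_a=\beta(a)$. The quadruple $(r_S,r_T,\alpha,\beta)$ is a matched product system of solutions if for all $a,b\in S$, $u,v\in T$: (s1) $\alpha_u\alpha_v=\alpha_{\lambda_u(v)}\alpha_{\rho_v(u)}$; (s2) $\beta_a\beta_b=\beta_{\lambda_a(b)}\beta_{\rho_b(a)}$; (s3) $\rho_{\alpha_u^{-1}(b)}\alpha^{-1}_{\beta_a(u)}(a)=\alpha^{-1}_{\beta_{\rho_b(a)}\beta_b^{-1}(u)}\rho_b(a)$; (s4) $\rho_{\beta_a^{-1}(v)}\beta^{-1}_{\alpha_u(a)}(u)=\beta^{-1}_{\alpha_{\rho_v(u)}\alpha_v^{-1}(a)}\rho_v(u)$;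 (s5) $\lambda_a\alpha_{\beta_a^{-1}(u)}=\alpha_u\lambda_{\alpha_u^{-1}(a)}$; (s6) $\lambda_u\beta_{\alpha_u^{-1}(a)}=\beta_a\lambda_{\beta_a^{-1}(u)}$. In that case the following map on $(S\times T)\times(S\times T)$ is a solution (known), called the matched product of $r_S$ and $r_T$ and denoted $r_S\bowtie r_T$: $$(r_S\bowtie r_T)((a,u),(b,v))=\Big(\big(A,U\big),\ \big(\alpha^{-1}_{\overline U}\rho_{\alpha_{\bar u}(b)}(a),\ \beta^{-1}_{\overline A}\rho_{\beta_{\bar a}(v)}(u)\big)\Big),$$ where $\bar a=\alpha_u^{-1}(a)$, $\bar u=\beta_a^{-1}(u)$, $A=\alpha_u\lambda_{\bar a}(b)$, $U=\beta_a\lambda_{\bar u}(v)$, $\overline A=\alpha_U^{-1}(A)$, $\overline U=\beta_A^{-1}(U)$. *)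

theory Defs
  imports Main
begin

text \<open>
  The underlying sets are rendered as types, so they are nonempty. This is needed: for empty \<open>S\<close>
  the matched product is the map on the empty set, whatever the order of the solution on \<open>T\<close>.
\<close>

definition is_solution :: "('x \<times> 'x \<Rightarrow> 'x \<times> 'x) \<Rightarrow> bool" where
  "is_solution r \<longleftrightarrow>
    (let r12 = (\<lambda>(x, y, z). (fst (r (x, y)), snd (r (x, y)), z));
         r23 = (\<lambda>(x, y, z). (x, r (y, z)))
     in r12 \<circ> r23 \<circ> r12 = r23 \<circ> r12 \<circ> r23)"

text \<open>The components of \<open>r (x, y) = (\<lambda>\<^sub>x y, \<rho>\<^sub>y x)\<close>; note the argument order of \<open>rho\<close>.\<close>

definition lam :: "('x \<times> 'x \<Rightarrow> 'x \<times> 'x) \<Rightarrow> 'x \<Rightarrow> 'x \<Rightarrow> 'x" where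
  "lam r x y = fst (r (x, y))"

definition rho :: "('x \<times> 'x \<Rightarrow> 'x \<times> 'x) \<Rightarrow> 'x \<Rightarrow> 'x \<Rightarrow> 'x" where
  "rho r y x = snd (r (x, y))"

definition finite_order :: "('y \<Rightarrow> 'y) \<Rightarrow> bool" where
  "finite_order r \<longleftrightarrow> (\<exists>i p :: nat. p \<ge> 1 \<and> r ^^ (p + i) = r ^^ i)"

definition matched_product_system ::
  "('s \<times> 's \<Rightarrow> 's \<times> 's) \<Rightarrow> ('t \<times> 't \<Rightarrow> 't \<times> 't) \<Rightarrow> ('t \<Rightarrow> 's \<Rightarrow> 's) \<Rightarrow> ('s \<Rightarrow> 't \<Rightarrow> 't) \<Rightarrow> bool" where
  "matched_product_system rS rT \<alpha> \<beta> \<longleftrightarrow>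
     is_solution rS \<and> is_solution rT \<and>
     (\<forall>u. bij (\<alpha> u)) \<and> (\<forall>a. bij (\<beta> a)) \<and>
     (\<forall>u v. \<alpha> u \<circ> \<alpha> v = \<alpha> (lam rT u v) \<circ> \<alpha> (rho rT v u)) \<and>
     (\<forall>a b. \<beta> a \<circ> \<beta> b = \<beta> (lam rS a b) \<circ> \<beta> (rho rS b a)) \<and>
     (\<forall>a b u. rho rS (inv (\<alpha> u) b) (inv (\<alpha> (\<beta> a u)) a)
            = inv (\<alpha> (\<beta> (rho rS b a) (inv (\<beta> b) u))) (rho rS b a)) \<and>
     (\<forall>u v a. rho rT (inv (\<beta> a) v) (inv (\<beta> (\<alpha> u a)) u)
            = inv (\<beta> (\<alpha> (rho rT v u) (inv (\<alpha> v) a))) (rho rT v u)) \<and>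
     (\<forall>a u. lam rS a \<circ> \<alpha> (inv (\<beta> a) u) = \<alpha> u \<circ> lam rS (inv (\<alpha> u) a)) \<and>
     (\<forall>a u. lam rT u \<circ> \<beta> (inv (\<alpha> u) a) = \<beta> a \<circ> lam rT (inv (\<beta> a) u))"

text \<open>
  With \<open>a' = \<alpha>\<^sub>u\<inverse>(a)\<close>, \<open>u' = \<beta>\<^sub>a\<inverse>(u)\<close>, \<open>A' = \<alpha>\<^sub>U\<inverse>(A)\<close>, \<open>U' = \<beta>\<^sub>A\<inverse>(U)\<close> for the usual barred elements.
\<close>

definition matched_product ::
  "('s \<times> 's \<Rightarrow> 's \<times> 's) \<Rightarrow> ('t \<times> 't \<Rightarrow> 't \<times> 't) \<Rightarrow> ('t \<Rightarrow> 's \<Rightarrow> 's) \<Rightarrow> ('s \<Rightarrow> 't \<Rightarrow> 't)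
    \<Rightarrow> ('s \<times> 't) \<times> ('s \<times> 't) \<Rightarrow> ('s \<times> 't) \<times> ('s \<times> 't)" where
  "matched_product rS rT \<alpha> \<beta> = (\<lambda>((a, u), (b, v)).
     let a' = inv (\<alpha> u) a;
         u' = inv (\<beta> a) u;
         A = \<alpha> u (lam rS a' b);
         U = \<beta> a (lam rT u' v);
         A' = inv (\<alpha> U) A;
         U' = inv (\<beta> A) U
     in ((A, U),
         (inv (\<alpha> U') (rho rS (\<alpha> u' b) a),
          inv (\<beta> A') (rho rT (\<beta> a' v) u))))"

end

theory Submission imports Defs begin

text \<open>
  Straightening the second argument by
  \<open>((a, u), (b, v)) \<mapsto> ((a, \<alpha>\<^bsub>u'\<^esub> b), (u, \<beta>\<^bsub>a'\<^esub> v))\<close>, with \<open>u' = \<beta>\<^sub>a\<inverse>(u)\<close> and \<open>a' = \<alpha>\<^sub>u\<inverse>(a)\<close>, is a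
  bijection that conjugates the matched product to the direct product of \<open>r\<^sub>S\<close> and \<open>r\<^sub>T\<close>. Indeed
  (s5) and (s6) turn \<open>A\<close> and \<open>U\<close> into the first components of \<open>r\<^sub>S\<close> and \<open>r\<^sub>T\<close> at the straightened
  arguments, and the inverse twists in the second components of the matched product are exactly those
  undone by straightening the image.
\<close>

text \<open>From index \<open>i\<close> on, the powers of \<open>f\<close> repeat with period
  \<open>p\<close>. So a later index and a multiple of the period serve as well, which lets two maps
  share both.\<close>

lemma funpow_eq_shift_mult:
  fixes f :: "'y \<Rightarrow> 'y"
  assumes "f ^^ (p + i) = f ^^ i" and "i \<le> k"
  shows "f ^^ (m * p + k) = f ^^ k"
proof (induction m)
  case (Suc m)
  have "Suc m * p + k = (m * p + (k - i)) + (p + i)" using assms(2) by simp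
  then have "f ^^ (Suc m * p + k) = f ^^ (m * p + (k - i)) \<circ> f ^^ (p + i)"
    by (simp only: funpow_add)
  also have "\<dots> = f ^^ (m * p + (k - i) + i)"
    by (subst assms(1)) (rule funpow_add[symmetric])
  also have "m * p + (k - i) + i = m * p + k" using assms(2) by simp
  finally show ?case using Suc.IH by simp
qed simp

lemma funpow_map_prod:
  fixes f :: "'x \<Rightarrow> 'x" and g :: "'y \<Rightarrow> 'y"
  shows "map_prod f g ^^ n = map_prod (f ^^ n) (g ^^ n)"
  by (induction n) (auto simp: map_prod.id fun_eq_iff)

text \<open>Types are inhabited, so fixing a point of one factor recovers the map on the
  other.\<close>

lemma map_prod_eq_iff: "map_prod f g = map_prod f' g' \<longleftrightarrow> f = f' \<and> g = g'"
  by (auto simp: fun_eq_iff)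

lemma finite_order_map_prod:
  "finite_order (map_prod f g) \<longleftrightarrow> finite_order f \<and> finite_order g"
proof
  assume "finite_order (map_prod f g)"
  then show "finite_order f \<and> finite_order g"
    unfolding finite_order_def funpow_map_prod map_prod_eq_iff by blast
next
  assume "finite_order f \<and> finite_order g"
  then obtain i p j q where p: "p \<ge> 1" "f ^^ (p + i) = f ^^ i"
    and q: "q \<ge> 1" "g ^^ (q + j) = g ^^ j"
    unfolding finite_order_def by blast
  \<comment> \<open>The larger index and the product of the periods suit both maps.\<close>
  have "f ^^ (q * p + max i j) = f ^^ max i j"
    using p(2) by (rule funpow_eq_shift_mult) simp
  moreover have "g ^^ (q * p + max i j) = g ^^ max i j"
    using funpow_eq_shift_mult[OF q(2), of "max i j" p] by (simp add: mult.commute)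
  moreover have "q * p \<ge> 1" using p(1) q(1) by simp
  ultimately show "finite_order (map_prod f g)"
    unfolding finite_order_def funpow_map_prod map_prod_eq_iff by blast
qed

text \<open>Equations between powers pass from \<open>f\<close> to \<open>g\<close> and back:
  injectivity of \<open>h\<close> cancels it on the left, surjectivity on the right.\<close>

lemma finite_order_conjugate:
  assumes "bij h" and "h \<circ> f = g \<circ> h"
  shows "finite_order f \<longleftrightarrow> finite_order g"
proof -
  have comm: "h \<circ> f ^^ n = g ^^ n \<circ> h" for n
  proof (induction n)
    case (Suc n)
    have "h \<circ> f ^^ Suc n = (h \<circ> f) \<circ> f ^^ n" by (simp add: comp_assoc)
    also have "\<dots> = g \<circ> (h \<circ> f ^^ n)" by (simp only: assms(2) comp_assoc)
    also have "\<dots> = g ^^ Suc n \<circ> h" by (simp only: Suc.IH funpow.simps comp_assoc)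
    finally show ?case .
  qed simp
  have "f ^^ m = f ^^ n \<longleftrightarrow> h \<circ> f ^^ m = h \<circ> f ^^ n" for m n
    using bij_is_inj[OF assms(1)] by (simp add: fun.inj_map_strong fun_eq_iff inj_eq)
  also have "h \<circ> f ^^ m = h \<circ> f ^^ n \<longleftrightarrow> g ^^ m = g ^^ n" for m n
    unfolding comm using bij_is_surj[OF assms(1)] by (auto simp: fun_eq_iff surj_def) metis
  finally show ?thesis unfolding finite_order_def by simp
qed

text \<open>The coordinates are also regrouped by factor, so that the direct product of the two
  solutions is literally \<open>map_prod rS rT\<close>.\<close>

definition straighten ::
  "('t \<Rightarrow> 's \<Rightarrow> 's) \<Rightarrow> ('s \<Rightarrow> 't \<Rightarrow> 't) \<Rightarrow> ('s \<times> 't) \<times> ('s \<times> 't) \<Rightarrow> ('s \<times> 's) \<times> ('t \<times> 't)" where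
  "straighten \<alpha> \<beta> = (\<lambda>((a, u), (b, v)). ((a, \<alpha> (inv (\<beta> a) u) b), (u, \<beta> (inv (\<alpha> u) a) v)))"

text \<open>Since \<open>a\<close> and \<open>u\<close> are kept, the permutations applied to
  \<open>b\<close> and \<open>v\<close> can be read off the image and undone.\<close>

lemma bij_straighten:
  assumes "\<And>u. bij (\<alpha> u)" and "\<And>a. bij (\<beta> a)"
  shows "bij (straighten \<alpha> \<beta>)"
proof (rule o_bij)
  let ?g = "\<lambda>((a, c), (u, w)). ((a, u), (inv (\<alpha> (inv (\<beta> a) u)) c, inv (\<beta> (inv (\<alpha> u) a)) w))"
  show "?g \<circ> straighten \<alpha> \<beta> = id"
    using assms by (auto simp: straighten_def fun_eq_iff bij_is_inj)
  show "straighten \<alpha> \<beta> \<circ> ?g = id"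
    using assms by (auto simp: straighten_def fun_eq_iff bij_is_surj surj_f_inv_f)
qed

lemma straighten_matched_product:
  assumes "matched_product_system rS rT \<alpha> \<beta>"
  shows "straighten \<alpha> \<beta> \<circ> matched_product rS rT \<alpha> \<beta> = map_prod rS rT \<circ> straighten \<alpha> \<beta>"
proof -
  have surj: "surj (\<alpha> u)" "surj (\<beta> a)" for u a
    using assms by (simp_all add: matched_product_system_def bij_is_surj)
  have s5: "\<alpha> u (lam rS (inv (\<alpha> u) a) b) = lam rS a (\<alpha> (inv (\<beta> a) u) b)" for a u b
    using assms by (simp add: matched_product_system_def fun_eq_iff)
  have s6: "\<beta> a (lam rT (inv (\<beta> a) u) v) = lam rT u (\<beta> (inv (\<alpha> u) a) v)" for a u v
    using assms by (simp add: matched_product_system_def fun_eq_iff)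
  \<comment> \<open>Brings \<open>map_prod rS rT\<close> into the \<open>lam\<close> and
    \<open>rho\<close> form in which the matched product is written.\<close>
  have "rS (a, b) = (lam rS a b, rho rS b a)" "rT (u, v) = (lam rT u v, rho rT v u)" for a b u v
    by (simp_all add: lam_def rho_def)
  then show ?thesis
    by (auto simp: fun_eq_iff straighten_def matched_product_def Let_def s5 s6
        surj surj_f_inv_f)
qed

theorem theorem8:
  fixes rS :: "'s \<times> 's \<Rightarrow> 's \<times> 's"
    and rT :: "'t \<times> 't \<Rightarrow> 't \<times> 't"
    and \<alpha> :: "'t \<Rightarrow> 's \<Rightarrow> 's"
    and \<beta> :: "'s \<Rightarrow> 't \<Rightarrow> 't"
  assumes "is_solution rS"
    and "is_solution rT"
    and "matched_product_system rS rT \<alpha> \<beta>"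
  shows "finite_order rS \<and> finite_order rT \<longleftrightarrow> finite_order (matched_product rS rT \<alpha> \<beta>)"
proof -
  have "bij (straighten \<alpha> \<beta>)"
    using assms(3) by (intro bij_straighten) (simp_all add: matched_product_system_def)
  then have "finite_order (matched_product rS rT \<alpha> \<beta>) \<longleftrightarrow> finite_order (map_prod rS rT)"
    using straighten_matched_product[OF assms(3)] by (rule finite_order_conjugate)
  then show ?thesis
    by (simp add: finite_order_map_prod)
qed

end
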